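(* Let $p^*$ be a probability distribution over $\mathcal X\times\mathcal Y$ and $x\in\mathcal X$ an input such that $p^*(\cdot\mid x)$ is non-deterministic (not a point mass). Then any deterministic decoding algorithm $\mathcal D$, with any next-token predictor $p_{ntp}$, has infinite cross-entropy loss on $x$: $$\mathbb E_{y\sim p^*(\cdot\mid x)}\big[-\log p_{\mathcal D(p_{ntp})\mid x}(y)\big]=+\infty.$$
   Context: $\mathcal X$ is an input space and $\mathcal Y$ a finite set of output sequences. A decoding algorithm $\mathcal D$ takes an input $x$ and a next-token predictor $p_{ntp}$ (a family of conditional distributions of the next token given the input and the previous tokens) and outputs a sequence in $\mathcal Y$; $p_{\mathcal D(p_{ntp})\mid x}$ denotes the distribution of its output. It is deterministic if it uses no internal randomness, i.e. $p_{\mathcal D(p_{ntp})\mid x}$ is a point mass. Convention: $-\log0=+\infty$. *)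

theory Defs
  imports "HOL-Probability.Probability"
begin

text \<open>
  A next-token predictor gives the distribution of the next token for an input and the list of
  previous tokens. A decoding algorithm is represented by its output law:
  \<open>\<D> p_ntp x\<close> is the distribution of the (possibly randomised) output on input \<open>x\<close>.
\<close>

type_synonym ('x, 'tok) predictor = "'x \<Rightarrow> 'tok list \<Rightarrow> 'tok pmf"

type_synonym ('x, 'tok) decoder = "('x, 'tok) predictor \<Rightarrow> 'x \<Rightarrow> 'tok list pmf"

definition point_mass :: "'a pmf \<Rightarrow> bool" where
  "point_mass p \<longleftrightarrow> (\<exists>y. p = return_pmf y)"

definition decoding_algorithm :: "'x set \<Rightarrow> 'tok list set \<Rightarrow> ('x, 'tok) decoder \<Rightarrow> bool" where
  "decoding_algorithm X Y \<D> \<longleftrightarrow> (\<forall>p_ntp. \<forall>x\<in>X. set_pmf (\<D> p_ntp x) \<subseteq> Y)"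

definition deterministic_decoder :: "'x set \<Rightarrow> ('x, 'tok) decoder \<Rightarrow> bool" where
  "deterministic_decoder X \<D> \<longleftrightarrow> (\<forall>p_ntp. \<forall>x\<in>X. point_mass (\<D> p_ntp x))"

text \<open>
  \<open>K\<close> is a (regular) conditional distribution of the output given the input under the joint
  law \<open>P\<close>. If \<open>{x}\<close> is measurable with positive marginal probability, this determines \<open>K x\<close> as the elementary
  conditional distribution; the input space itself need not be discrete.
\<close>

definition conditional_distribution ::
    "'x measure \<Rightarrow> 'y set \<Rightarrow> ('x \<times> 'y) measure \<Rightarrow> ('x \<Rightarrow> 'y pmf) \<Rightarrow> bool" where
  "conditional_distribution X Y P K \<longleftrightarrow>
     (\<forall>x\<in>space X. set_pmf (K x) \<subseteq> Y) \<and>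
     (\<forall>y\<in>Y. (\<lambda>x. pmf (K x) y) \<in> borel_measurable X) \<and>
     (\<forall>A\<in>sets X. \<forall>y\<in>Y.
        emeasure P (A \<times> {y}) = (\<integral>\<^sup>+x\<in>A. ennreal (pmf (K x) y) \<partial>distr P X fst))"

text \<open>
  For probabilities \<open>t \<in> {0..1}\<close>, so that \<open>- ln t \<ge> 0\<close> and the truncation
  in \<^const>\<open>ennreal\<close> has no effect; the case split is the convention \<open>- log 0 = \<infinity>\<close>.
\<close>

definition neg_log :: "real \<Rightarrow> ennreal" where
  "neg_log t = (if t = 0 then \<infinity> else ennreal (- ln t))"

definition cross_entropy :: "'a pmf \<Rightarrow> 'a pmf \<Rightarrow> ennreal" where
  "cross_entropy p q = (\<integral>\<^sup>+y. neg_log (pmf q y) \<partial>measure_pmf p)"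

end

theory Submission
  imports Defs
begin

text \<open>A deterministic decoder puts all its mass on one sequence z, while the support of a law
  that is not a point mass contains some y different from z. At y the loss is -log 0, and y has
  positive probability, so this single atom already makes the expectation infinite.\<close>

lemma cross_entropy_eq_infinity:
  assumes "y \<in> set_pmf p" and "pmf q y = 0"
  shows "cross_entropy p q = \<infinity>"
proof -
  \<comment> \<open>Support membership makes the mass of \<open>{y}\<close> nonzero; in
    \<open>ennreal\<close>, infinity times 0 would be 0.\<close>
  have "\<infinity> = \<infinity> * emeasure (measure_pmf p) {y}"
    using assms(1) by (simp add: emeasure_pmf_single ennreal_top_mult set_pmf_iff)
  also have "\<dots> = (\<integral>\<^sup>+z. \<infinity> * indicator {y} z \<partial>measure_pmf p)"
    by (subst nn_integral_cmult_indicator) simp_all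
  also have "\<dots> \<le> cross_entropy p q"
    unfolding cross_entropy_def
    by (rule nn_integral_mono) (simp add: neg_log_def assms(2) split: split_indicator)
  finally show ?thesis
    by (simp add: top_unique)
qed

text \<open>A pmf whose support lies in \<open>{z}\<close> must be
  \<open>return_pmf z\<close>.\<close>

lemma not_point_mass_obtain_support:
  assumes "\<not> point_mass p"
  obtains y where "y \<in> set_pmf p" and "y \<noteq> z"
  using assms set_pmf_subset_singleton[of p z] by (auto simp: point_mass_def)

theorem mainTheorem7:
  fixes X :: "'x measure"
    and Y :: "'tok list set"
    and p_star :: "('x \<times> 'tok list) measure"
    and p_star_cond :: "'x \<Rightarrow> 'tok list pmf"
    and x :: 'x
    and \<D> :: "('x, 'tok) decoder"
    and p_ntp :: "('x, 'tok) predictor"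
  assumes "finite Y"
    and "prob_space p_star"
    and "sets p_star = sets (X \<Otimes>\<^sub>M count_space Y)"
    and "conditional_distribution X Y p_star p_star_cond"
    and "x \<in> space X"
    and "\<not> point_mass (p_star_cond x)"
    and "decoding_algorithm (space X) Y \<D>"
    and "deterministic_decoder (space X) \<D>"
  shows "cross_entropy (p_star_cond x) (\<D> p_ntp x) = \<infinity>"
proof -
  obtain z where z: "\<D> p_ntp x = return_pmf z"
    using assms(5,8) unfolding deterministic_decoder_def point_mass_def by blast
  obtain y where "y \<in> set_pmf (p_star_cond x)" and "y \<noteq> z"
    using not_point_mass_obtain_support[OF assms(6)] .
  \<comment> \<open>\<open>return_pmf z\<close> gives y mass 0 because y differs from z.\<close>
  then show ?thesis
    unfolding z by (intro cross_entropy_eq_infinity) (auto split: split_indicator)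
qed

end
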